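(* Kaden spirals (as well as the Anton and Pullin spirals), if they exist and satisfy the similitude law $$\Gamma(B(0,r))=c_2(t)\,r^{\lambda},$$ where $\lambda>0$ is related to the self-similarity exponent $m$ of the spiral by $\lambda=2-\frac1m$ (so $\lambda=\frac12$ for the Kaden and Anton spirals), are locally elements of $H^{-1}(\mathbb{R}^2)$; that is, the measure $\Gamma$ generated by the spiral belongs locally to $H^{-1}(\mathbb{R}^2)$.
   Context: Identify $\mathbb{R}^2$ with $\mathbb{C}$. The spirals in question are self-similar vortex sheets, i.e. flows that are incompressible, and irrotational off a curve on which the vorticity is concentrated. They are sought with a complex velocity potential of the form $w(x,y)=At^{2m-1}\vartheta\left(\frac{x}{t^m},\frac{y}{t^m}\right)$, with $A$ a constant, $m>0$ and $\vartheta$ some profile, or, alternatively, with the position of the curve and the cumulated vorticity at time $t$ given by $z(t,\theta)=t^{m}f(\theta)e^{i\theta}$, $\Gamma(t,\theta)=t^{2m-1}g(\theta)$, with self-similarity profiles $f,g$. The profiles are determined for instance by plugging the ansatz into the Birkhoff-Rott equation $\frac{d}{dt}\bar z(\Gamma,t)=\frac{1}{2\pi i}\,\mathrm{p.v.}\!\int\frac{d\Gamma'}{z(\Gamma,t)-z(\Gamma',t)}$. Kaden spirals correspond to $m=\frac23$; the Anton spiral (describing the impulsive flow past a flat plate) also corresponds to $m=\frac23$; Pullin spirals are those with $0<m<2$ studied numerically through the Birkhoff-Rott equation. The existence of such spirals is not rigorously established and is part of the hypothesis. The cumulated vorticity at a point $z$ of the curve is the integral of the vorticity strength along the arc joining the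 origin with $z$. The measure generated by the spiral, also denoted $\Gamma$, is supported on the curve and assigns to a subarc connecting $z_1$ and $z_2$ the difference $\Gamma(z_2)-\Gamma(z_1)$ of cumulated vorticities; for a Borel set $A$ it equals the measure of the intersection of $A$ with the curve. $B(0,r)$ is the ball of radius $r$ centered at $0$, and $c_2(t)$ is a coefficient depending on the time $t$ only. A measure belongs locally to $H^{-1}(\mathbb{R}^2)$ if its restriction to any ball $B(0,R_0)$ belongs to $H^{-1}(\mathbb{R}^2)$. A tempered distribution $f$ belongs to $H^{-1}(\mathbb{R}^2)$ if $\int_{\mathbb{R}^2}(1+|\xi|^2)^{-1}|\hat f(\xi)|^2\,d\xi<\infty$, where $\hat f$ is the Fourier transform of $f$. *)

theory Defs
  imports "HOL-Complex_Analysis.Complex_Analysis" "HOL-Probability.Probability"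
begin

text \<open>
  The plane is \<^typ>\<open>complex\<close>.  A spiral with similarity exponent \<open>m\<close> is given by two profiles
  \<open>f, g\<close> on an unbounded interval \<open>I\<close> of polar angles, the centre being reached as \<open>\<theta> \<rightarrow> \<infinity>\<close>.
\<close>

definition position :: "real \<Rightarrow> (real \<Rightarrow> real) \<Rightarrow> real \<Rightarrow> real \<Rightarrow> complex"
  where "position m f t \<theta> = of_real (t powr m * f \<theta>) * cis \<theta>"

definition cumulated_vorticity :: "real \<Rightarrow> (real \<Rightarrow> real) \<Rightarrow> real \<Rightarrow> real \<Rightarrow> real"
  where "cumulated_vorticity m g t \<theta> = t powr (2 * m - 1) * g \<theta>"

definition sheet :: "real \<Rightarrow> real set \<Rightarrow> (real \<Rightarrow> real) \<Rightarrow> real \<Rightarrow> complex set"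
  where "sheet m I f t = position m f t ` I"

definition spiral_profiles :: "real set \<Rightarrow> (real \<Rightarrow> real) \<Rightarrow> (real \<Rightarrow> real) \<Rightarrow> bool"
  where "spiral_profiles I f g \<longleftrightarrow>
    is_interval I \<and> \<not> bdd_above I \<and>
    continuous_on I f \<and> (\<forall>\<theta>\<in>I. f \<theta> > 0) \<and> (f \<longlongrightarrow> 0) at_top \<and>
    inj_on (\<lambda>\<theta>. of_real (f \<theta>) * cis \<theta>) I \<and>
    (g \<longlongrightarrow> 0) at_top"

text \<open>
  The measure generated by the spiral at time \<open>t\<close>.  Vorticity is cumulated outwards from the
  centre, hence decreases in \<open>\<theta>\<close>; the monotonicity clause is needed because \<^const>\<open>ennreal\<close>
  truncates negative numbers.
\<close>

definition generated_measure ::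
  "real \<Rightarrow> real set \<Rightarrow> (real \<Rightarrow> real) \<Rightarrow> (real \<Rightarrow> real) \<Rightarrow> real \<Rightarrow> complex measure \<Rightarrow> bool"
  where "generated_measure m I f g t M \<longleftrightarrow>
    sets M = sets borel \<and>
    (\<forall>\<theta>\<^sub>1\<in>I. \<forall>\<theta>\<^sub>2\<in>I. \<theta>\<^sub>1 \<le> \<theta>\<^sub>2 \<longrightarrow>
       cumulated_vorticity m g t \<theta>\<^sub>2 \<le> cumulated_vorticity m g t \<theta>\<^sub>1 \<and>
       emeasure M (position m f t ` {\<theta>\<^sub>1..\<theta>\<^sub>2}) =
         ennreal (cumulated_vorticity m g t \<theta>\<^sub>1 - cumulated_vorticity m g t \<theta>\<^sub>2)) \<and>
    (\<forall>A\<in>sets borel. emeasure M A = emeasure M (A \<inter> sheet m I f t))"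

text \<open>
  An incompressible flow \<open>v\<close> with vorticity \<open>M\<close>, in the sense of distributions, written in terms
  of the complex velocity \<open>V = v\<^sub>1 - i v\<^sub>2\<close>.  Only local integrability is required:
  local square integrability of \<open>v\<close> would amount to local membership of \<open>M\<close> in the
  Sobolev space of order \<open>-1\<close>.
\<close>

definition flow_with_vorticity :: "(complex \<Rightarrow> complex) \<Rightarrow> complex measure \<Rightarrow> bool"
  where "flow_with_vorticity V M \<longleftrightarrow>
    (\<forall>R. set_integrable lborel (ball 0 R) V) \<and>
    (\<forall>(\<phi> :: complex \<Rightarrow> real) \<phi>x \<phi>y.
       (\<forall>p. (\<phi> has_derivative (\<lambda>h. \<phi>x p * Re h + \<phi>y p * Im h)) (at p)) \<and>
       continuous_on UNIV \<phi>x \<and> continuous_on UNIV \<phi>y \<and> bounded {p. \<phi> p \<noteq> 0} \<longrightarrow>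
       (LINT p|lborel. Re (V p) * \<phi>x p - Im (V p) * \<phi>y p) = 0 \<and>
       (LINT p|lborel. Re (V p) * \<phi>y p + Im (V p) * \<phi>x p) = (LINT p|M. \<phi> p))"

text \<open>
  The flow has a complex potential \<open>w = A t\<^bsup>2m-1\<^esup> \<Theta>(x/t\<^bsup>m\<^esup>, y/t\<^bsup>m\<^esup>)\<close>, so it is irrotational off
  the sheet; the complex velocity is the derivative of \<open>w\<close>.
\<close>

definition self_similar_potential_flow ::
  "real \<Rightarrow> real set \<Rightarrow> (real \<Rightarrow> real) \<Rightarrow> (real \<Rightarrow> complex measure) \<Rightarrow> bool"
  where "self_similar_potential_flow m I f \<Gamma> \<longleftrightarrow>
    (\<exists>(A :: complex) (\<Theta> :: complex \<Rightarrow> complex) (w :: real \<Rightarrow> complex \<Rightarrow> complex).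
       (\<forall>t>0. \<forall>p. w t p = A * of_real (t powr (2 * m - 1)) * \<Theta> (p / of_real (t powr m))) \<and>
       (\<forall>t>0. w t holomorphic_on - closure (sheet m I f t)) \<and>
       (\<forall>t>0. flow_with_vorticity (deriv (w t)) (\<Gamma> t)))"

text \<open>
  The principal value is taken at the singularity and at infinity, since sheets may be unbounded.
\<close>

definition has_pv_cauchy_integral :: "complex measure \<Rightarrow> complex \<Rightarrow> complex \<Rightarrow> bool"
  where "has_pv_cauchy_integral M z P \<longleftrightarrow>
    ((\<lambda>(\<epsilon>, R). LINT z':{z'. \<epsilon> < dist z z' \<and> dist z z' < R}|M. 1 / (z - z')) \<longlongrightarrow> P)
      (at_right 0 \<times>\<^sub>F at_top)"

text \<open>
  In the Birkhoff-Rott equation the position \<open>Z G t\<close> is a function of the Lagrangian variable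
  \<open>G\<close>, the cumulated vorticity, and is differentiated in time at fixed \<open>G\<close>.  An end point of the
  sheet is excluded, as its value of \<open>G\<close> need not be attained at neighbouring times.
\<close>

definition birkhoff_rott ::
  "real \<Rightarrow> real set \<Rightarrow> (real \<Rightarrow> real) \<Rightarrow> (real \<Rightarrow> real) \<Rightarrow> (real \<Rightarrow> complex measure) \<Rightarrow> bool"
  where "birkhoff_rott m I f g \<Gamma> \<longleftrightarrow>
    (\<exists>Z :: real \<Rightarrow> real \<Rightarrow> complex.
       (\<forall>t>0. \<forall>\<theta>\<in>I. Z (cumulated_vorticity m g t \<theta>) t = position m f t \<theta>) \<and>
       (\<forall>t>0. \<forall>\<theta>\<in>interior I. \<exists>P.
          has_pv_cauchy_integral (\<Gamma> t) (position m f t \<theta>) P \<and>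
          ((\<lambda>s. cnj (Z (cumulated_vorticity m g t \<theta>) s)) has_vector_derivative
             1 / (2 * of_real pi * \<i>) * P) (at t)))"

text \<open>
  The flow may be specified by its potential or, alternatively, by the Birkhoff-Rott equation.
  The first description still makes sense when the integral in the latter diverges at infinity,
  as it may for an unbounded sheet with \<open>m \<ge> 1\<close>.
\<close>

definition self_similar_spiral ::
  "real \<Rightarrow> real set \<Rightarrow> (real \<Rightarrow> real) \<Rightarrow> (real \<Rightarrow> real) \<Rightarrow> (real \<Rightarrow> complex measure) \<Rightarrow> bool"
  where "self_similar_spiral m I f g \<Gamma> \<longleftrightarrow>
    m > 0 \<and> spiral_profiles I f g \<and>
    (\<forall>t>0. generated_measure m I f g t (\<Gamma> t)) \<and>
    (self_similar_potential_flow m I f \<Gamma> \<or> birkhoff_rott m I f g \<Gamma>)"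

definition kaden_spiral ::
  "real \<Rightarrow> real set \<Rightarrow> (real \<Rightarrow> real) \<Rightarrow> (real \<Rightarrow> real) \<Rightarrow> (real \<Rightarrow> complex measure) \<Rightarrow> bool"
  where "kaden_spiral m I f g \<Gamma> \<longleftrightarrow> self_similar_spiral m I f g \<Gamma> \<and> m = 2 / 3"

text \<open>Anton's spiral comes from a different physical setting, but has the exponent of Kaden's.\<close>

definition anton_spiral ::
  "real \<Rightarrow> real set \<Rightarrow> (real \<Rightarrow> real) \<Rightarrow> (real \<Rightarrow> real) \<Rightarrow> (real \<Rightarrow> complex measure) \<Rightarrow> bool"
  where "anton_spiral m I f g \<Gamma> \<longleftrightarrow> self_similar_spiral m I f g \<Gamma> \<and> m = 2 / 3"

definition pullin_spiral ::
  "real \<Rightarrow> real set \<Rightarrow> (real \<Rightarrow> real) \<Rightarrow> (real \<Rightarrow> real) \<Rightarrow> (real \<Rightarrow> complex measure) \<Rightarrow> bool"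
  where "pullin_spiral m I f g \<Gamma> \<longleftrightarrow> self_similar_spiral m I f g \<Gamma> \<and> 0 < m \<and> m < 2"

text \<open>Finiteness is explicit because \<^const>\<open>measure\<close> is \<open>0\<close> on sets of infinite measure.\<close>

definition similitude_law :: "(real \<Rightarrow> complex measure) \<Rightarrow> (real \<Rightarrow> real) \<Rightarrow> real \<Rightarrow> bool"
  where "similitude_law \<Gamma> c\<^sub>2 lam \<longleftrightarrow>
    (\<forall>t>0. \<forall>r>0. emeasure (\<Gamma> t) (ball 0 r) < \<infinity> \<and>
       measure (\<Gamma> t) (ball 0 r) = c\<^sub>2 t * r powr lam)"

definition fourier_transform :: "complex measure \<Rightarrow> complex \<Rightarrow> complex"
  where "fourier_transform M \<xi> = (LINT x|M. cis (- (x \<bullet> \<xi>)))"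

text \<open>
  For a finite Borel measure, the Fourier transform as a tempered distribution is the function
  above.
\<close>

definition in_H_minus_1 :: "complex measure \<Rightarrow> bool"
  where "in_H_minus_1 M \<longleftrightarrow>
    finite_measure M \<and> sets M = sets borel \<and>
    (\<integral>\<^sup>+ \<xi>. ennreal ((norm (fourier_transform M \<xi>))\<^sup>2 / (1 + (norm \<xi>)\<^sup>2)) \<partial>lborel) < \<infinity>"

definition locally_in_H_minus_1 :: "complex measure \<Rightarrow> bool"
  where "locally_in_H_minus_1 M \<longleftrightarrow>
    (\<forall>R\<^sub>0>0. in_H_minus_1 (density M (indicator (ball 0 R\<^sub>0))))"

end

theory Submission imports Defs "HOL-Real_Asymp.Real_Asymp"
begin

text \<open>
  Only the radial law matters.  Writing \<open>1 / (1 + |\<xi>|\<^sup>2)\<close> as the integral of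
  \<open>exp (- s (1 + |\<xi>|\<^sup>2))\<close> over \<open>s > 0\<close> turns the Sobolev norm of a finite measure \<open>M\<close> into an
  average of the Gaussian energies \<open>(\<pi> / s) \<integral>\<integral> exp (- |x - y|\<^sup>2 / (4 s)) dM(x) dM(y)\<close>.
  Since \<open>|x - y| \<ge> \<bar>|x| - |y|\<bar>\<close>, the inner integral is controlled by the masses of annuli
  centred at the origin.  The similitude law makes the mass of an annulus of width \<open>\<delta>\<close> in a
  fixed ball \<open>O(\<delta>\<^sup>\<alpha>)\<close> with \<open>\<alpha> = min \<lambda> 1\<close>, so the inner integral is \<open>O(s\<^bsup>\<alpha>/2\<^esup>)\<close> and what remains
  is a convergent Gamma integral.
\<close>

section \<open>Fourier transforms of Gaussians\<close>

text \<open>\<open>lborel\<close> is the image of a product of one-dimensional Lebesgue measures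
  under the map \<open>?g\<close> that assembles coordinates, so Fubini on the product measure
  factors the integral.\<close>

lemma has_bochner_integral_lborel_prod:
  fixes f :: "'a::euclidean_space \<Rightarrow> real \<Rightarrow> 'b::{real_normed_field,banach,second_countable_topology}"
  assumes f: "\<And>b. b \<in> Basis \<Longrightarrow> integrable lborel (f b)"
  shows "has_bochner_integral lborel (\<lambda>x::'a. \<Prod>b\<in>Basis. f b (x \<bullet> b))
    (\<Prod>b\<in>Basis. integral\<^sup>L lborel (f b))"
proof -
  interpret product_sigma_finite "\<lambda>b::'a. lborel :: real measure" ..
  let ?P = "Pi\<^sub>M (Basis :: 'a set) (\<lambda>b. lborel :: real measure)"
  let ?g = "\<lambda>h. \<Sum>b\<in>Basis. h b *\<^sub>R b :: 'a"
  have fm [measurable]: "f b \<in> borel_measurable borel" if "b \<in> Basis" for b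
    using borel_measurable_integrable[OF f[OF that]] by simp
  have comp: "(\<Prod>b\<in>Basis. f b (?g h \<bullet> b)) = (\<Prod>b\<in>Basis. f b (h b))" for h
    by (intro prod.cong) (simp_all add: inner_sum_left inner_Basis if_distrib cong: if_cong)
  have gm: "?g \<in> measurable ?P borel"
    by (intro borel_measurable_sum borel_measurable_scaleR) auto
  have "integrable (distr ?P borel ?g) (\<lambda>x. \<Prod>b\<in>Basis. f b (x \<bullet> b))"
    using product_integrable_prod[OF finite_Basis f]
    by (subst integrable_distr_eq[OF gm]) (simp_all add: comp)
  moreover have "integral\<^sup>L (distr ?P borel ?g) (\<lambda>x. \<Prod>b\<in>Basis. f b (x \<bullet> b)) =
      (\<Prod>b\<in>Basis. integral\<^sup>L lborel (f b))"
    using product_integral_prod[OF finite_Basis f]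
    by (subst integral_distr[OF gm]) (simp_all add: comp)
  ultimately show ?thesis
    unfolding has_bochner_integral_iff by (simp add: lborel_eq[where 'a='a])
qed

lemma borel_measurable_cis [measurable]: "cis \<in> borel_measurable borel"
  by (intro borel_measurable_continuous_onI continuous_intros)

lemma integrable_gaussian:
  assumes "s > 0"
  shows "integrable lborel (\<lambda>x::real. exp (- (s * x\<^sup>2)))"
proof -
  \<comment> \<open>A normal density of variance \<open>1 / (2 * s)\<close> has exponent
    \<open>- (s * x\<^sup>2)\<close>; the prefactor cancels its normalisation.\<close>
  have "integrable lborel (\<lambda>x. sqrt (2 * pi * (1 / sqrt (2 * s))\<^sup>2) * normal_density 0 (1 / sqrt (2 * s)) x)"
    using assms by (intro integrable_mult_right) simp
  also have "(\<lambda>x. sqrt (2 * pi * (1 / sqrt (2 * s))\<^sup>2) * normal_density 0 (1 / sqrt (2 * s)) x) =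
      (\<lambda>x. exp (- (s * x\<^sup>2)))"
    using assms by (auto simp: normal_density_def fun_eq_iff field_simps power_divide)
  finally show ?thesis .
qed

text \<open>A rescaling of the characteristic function of the standard normal law, evaluated at
  \<open>- (a / c)\<close>.\<close>

lemma has_bochner_integral_gaussian_cis_real:
  assumes s: "s > 0"
  shows "has_bochner_integral lborel (\<lambda>x::real. of_real (exp (- (s * x\<^sup>2))) * cis (- (a * x)))
    (of_real (sqrt (pi / s) * exp (- (a\<^sup>2 / (4 * s)))))"
proof -
  \<comment> \<open>Replacing \<open>x\<close> by \<open>c * x\<close> turns
    \<open>x\<^sup>2 / 2\<close> into \<open>s * x\<^sup>2\<close> and the frequency
    \<open>a / c\<close> into \<open>a\<close>.\<close>
  define c where "c = sqrt (2 * s)"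
  have c: "c > 0" "c\<^sup>2 = 2 * s" using s by (auto simp: c_def)
  have int: "integrable lborel (\<lambda>x::real. of_real (exp (- (s * x\<^sup>2))) * cis (- (a * x)))"
    by (rule Bochner_Integration.integrable_bound[OF integrable_gaussian[OF s]])
       (auto simp: norm_mult)
  let ?f = "\<lambda>x. complex_of_real (exp (- (x\<^sup>2 / 2))) * cis (- (a / c * x))"
  have "of_real (exp (- ((a / c)\<^sup>2) / 2)) = char std_normal_distribution (- (a / c))"
    by (simp add: char_std_normal_distribution)
  also have "\<dots> = (LINT x|lborel. std_normal_density x *\<^sub>R cis (- (a / c) * x))"
    unfolding char_def by (subst integral_density) (auto simp: cis_conv_exp)
  also have "\<dots> = (LINT x|lborel. (1 / sqrt (2 * pi)) *\<^sub>R ?f x)"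
    by (simp add: std_normal_density_def scaleR_conv_of_real)
  also have "\<dots> = (1 / sqrt (2 * pi)) *\<^sub>R (LINT x|lborel. ?f x)"
    by simp
  also have "(LINT x|lborel. ?f x) = c *\<^sub>R (LINT x|lborel. ?f (0 + c * x))"
    using c by (subst lborel_integral_real_affine[of c _ 0]) auto
  also have "(\<lambda>x. ?f (0 + c * x)) = (\<lambda>x. of_real (exp (- (s * x\<^sup>2))) * cis (- (a * x)))"
    using c by (auto simp: power_mult_distrib)
  finally have eq: "of_real (exp (- ((a / c)\<^sup>2) / 2)) =
    (c / sqrt (2 * pi)) *\<^sub>R (LINT x|lborel. of_real (exp (- (s * x\<^sup>2))) * cis (- (a * x)))"
    by simp
  have "(LINT x|lborel. of_real (exp (- (s * x\<^sup>2))) * cis (- (a * x))) =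
     (sqrt (2 * pi) / c) *\<^sub>R complex_of_real (exp (- ((a / c)\<^sup>2) / 2))"
    unfolding eq using c by simp
  also have "\<dots> = of_real (sqrt (2 * pi) / c * exp (- ((a / c)\<^sup>2) / 2))"
    by (simp add: scaleR_conv_of_real)
  also have "sqrt (2 * pi) / c = sqrt (pi / s)"
    using s by (simp add: c_def real_sqrt_divide[symmetric])
  also have "- ((a / c)\<^sup>2) / 2 = - (a\<^sup>2 / (4 * s))"
    using c by (simp add: power_divide)
  finally show ?thesis
    using int by (simp add: has_bochner_integral_iff)
qed

text \<open>The squared norm and the inner product are sums over \<open>Basis\<close>, so the
  integrand is a product of one-dimensional ones, each contributing a factor
  \<open>sqrt (pi / s)\<close>.\<close>

lemma has_bochner_integral_gaussian_cis:
  fixes z :: "'a::euclidean_space"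
  assumes s: "s > 0"
  shows "has_bochner_integral lborel (\<lambda>\<xi>. of_real (exp (- (s * (norm \<xi>)\<^sup>2))) * cis (- (z \<bullet> \<xi>)))
    (of_real (sqrt (pi / s) ^ DIM('a) * exp (- ((norm z)\<^sup>2 / (4 * s)))))"
proof -
  have norm_sq: "(norm x)\<^sup>2 = (\<Sum>b\<in>Basis. (x \<bullet> b)\<^sup>2)" for x :: 'a
    unfolding power2_norm_eq_inner by (subst euclidean_inner) (simp add: power2_eq_square)
  have prod_cis: "(\<Prod>b\<in>B. cis (h b)) = cis (sum h B)" for h and B :: "'a set"
    by (induction B rule: infinite_finite_induct) (auto simp: cis_mult)
  have inner_expand: "(\<lambda>\<xi>. of_real (exp (- (s * (norm \<xi>)\<^sup>2))) * cis (- (z \<bullet> \<xi>))) =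
    (\<lambda>\<xi>. of_real (exp (- (s * (norm \<xi>)\<^sup>2))) * cis (- (\<Sum>b\<in>Basis. (z \<bullet> b) * (\<xi> \<bullet> b))))"
    by (subst euclidean_inner) simp
  have "(\<lambda>\<xi>. of_real (exp (- (s * (norm \<xi>)\<^sup>2))) * cis (- (z \<bullet> \<xi>))) =
    (\<lambda>\<xi>. \<Prod>b\<in>Basis. of_real (exp (- (s * (\<xi> \<bullet> b)\<^sup>2))) * cis (- ((z \<bullet> b) * (\<xi> \<bullet> b))))"
    unfolding inner_expand by (simp add: prod.distrib prod_cis norm_sq sum_negf sum_distrib_left
        flip: of_real_prod exp_sum)
  moreover have "complex_of_real (sqrt (pi / s) ^ DIM('a) * exp (- ((norm z)\<^sup>2 / (4 * s)))) =
     (\<Prod>b\<in>Basis. LINT x|lborel. of_real (exp (- (s * x\<^sup>2))) * cis (- ((z \<bullet> b) * x)))"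
    using has_bochner_integral_gaussian_cis_real[OF s]
    by (simp add: has_bochner_integral_iff prod.distrib norm_sq sum_negf sum_divide_distrib
        flip: of_real_prod exp_sum)
  moreover have "integrable lborel (\<lambda>x. of_real (exp (- (s * x\<^sup>2))) * cis (- (a * x)))" for a
    using has_bochner_integral_gaussian_cis_real[OF s] by (simp add: has_bochner_integral_iff)
  ultimately show ?thesis
    by (simp only:) (rule has_bochner_integral_lborel_prod)
qed

section \<open>Gaussian energies and the Sobolev norm\<close>

text \<open>The squared modulus of the transform is a double integral over \<open>M\<close> of a
  phase in \<open>x - y\<close>; integrating over \<xi> first leaves the transform of a Gaussian at
  \<open>x - y\<close>. The factor \<open>pi / s\<close> is the square of
  \<open>sqrt (pi / s)\<close>, the plane having dimension 2.\<close>

lemma nn_integral_fourier_transform_gaussian: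
  assumes "finite_measure M" and sets [measurable_cong]: "sets M = sets borel" and s: "s > 0"
  shows "(\<integral>\<^sup>+\<xi>. ennreal ((norm (fourier_transform M \<xi>))\<^sup>2 * exp (- (s * (norm \<xi>)\<^sup>2))) \<partial>lborel) =
    (\<integral>\<^sup>+x. \<integral>\<^sup>+y. ennreal (pi / s * exp (- ((norm (x - y))\<^sup>2 / (4 * s)))) \<partial>M \<partial>M)"
proof -
  interpret finite_measure M by fact
  interpret MM: pair_sigma_finite M M ..
  interpret MM: finite_measure "M \<Otimes>\<^sub>M M"
    by (rule finite_measure_pair_measure) fact+
  interpret P: pair_sigma_finite "lborel :: complex measure" "M \<Otimes>\<^sub>M M" ..
  define F where "F = (\<lambda>\<xi> (x, y). of_real (exp (- (s * (norm \<xi>)\<^sup>2))) * cis (- ((x - y :: complex) \<bullet> \<xi>)))"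
  have Fm [measurable]: "case_prod F \<in> borel_measurable (lborel \<Otimes>\<^sub>M (M \<Otimes>\<^sub>M M))"
    unfolding F_def by measurable
  have int_exp: "integrable lborel (\<lambda>\<xi>::complex. exp (- (s * (norm \<xi>)\<^sup>2)))"
    using has_bochner_integral_gaussian_cis[OF s, of "0::complex"]
    by (auto simp: has_bochner_integral_iff dest: integrable_norm)
  have norm_F: "norm (F \<xi> p) = exp (- (s * (norm \<xi>)\<^sup>2))" for \<xi> p
    by (auto simp: F_def norm_mult split: prod.splits)
  \<comment> \<open>The modulus of \<open>F\<close> is a Gaussian in \<xi> alone, so the finite mass
    of the product measure gives the absolute integrability that Fubini requires.\<close>
  have intF: "integrable (lborel \<Otimes>\<^sub>M (M \<Otimes>\<^sub>M M)) (case_prod F)"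
  proof (rule P.Fubini_integrable[OF Fm])
    show "integrable lborel (\<lambda>x. LINT y|(M \<Otimes>\<^sub>M M). norm (case (x, y) of (x, xa) \<Rightarrow> F x xa))"
      using int_exp by (simp add: norm_F)
    show "AE x in lborel. integrable (M \<Otimes>\<^sub>M M) (\<lambda>y. case (x, y) of (x, xa) \<Rightarrow> F x xa)"
      by (intro AE_I2 MM.integrable_const_bound[where B = 1]) (auto simp: norm_F less_imp_le[OF s])
  qed
  have energy: "of_real ((norm (fourier_transform M \<xi>))\<^sup>2 * exp (- (s * (norm \<xi>)\<^sup>2))) =
      (LINT p|(M \<Otimes>\<^sub>M M). F \<xi> p)" for \<xi>
  proof -
    have "complex_of_real ((norm (fourier_transform M \<xi>))\<^sup>2) =
      (LINT x|M. cis (- (x \<bullet> \<xi>))) * (LINT y|M. cis (y \<bullet> \<xi>))"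
      unfolding complex_norm_square fourier_transform_def
      by (simp only: Bochner_Integration.integral_cnj[symmetric] cis_cnj minus_minus)
    also have "\<dots> = (LINT x|M. LINT y|M. cis (- (x \<bullet> \<xi>)) * cis (y \<bullet> \<xi>))"
      by simp
    also have "\<dots> = (LINT x|M. LINT y|M. cis (- ((x - y) \<bullet> \<xi>)))"
      by (simp add: cis_mult inner_diff_left)
    finally have "complex_of_real ((norm (fourier_transform M \<xi>))\<^sup>2 * exp (- (s * (norm \<xi>)\<^sup>2))) =
      (LINT x|M. LINT y|M. F \<xi> (x, y))"
      by (simp add: F_def mult.commute)
    also have "\<dots> = (LINT p|(M \<Otimes>\<^sub>M M). F \<xi> p)"
      by (rule MM.integral_fst', rule MM.integrable_const_bound[where B = 1])
         (auto simp: norm_F less_imp_le[OF s])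
    finally show ?thesis .
  qed
  have gauss: "(LINT \<xi>|lborel. F \<xi> (x, y)) = of_real (pi / s * exp (- ((norm (x - y))\<^sup>2 / (4 * s))))"
    for x y
    using has_bochner_integral_gaussian_cis[OF s, of "x - y"] s
    by (simp add: F_def has_bochner_integral_iff)
  let ?K = "\<lambda>p. pi / s * exp (- ((norm (fst p - snd p :: complex))\<^sup>2 / (4 * s)))"
  have K_eq: "(LINT \<xi>|lborel. F \<xi> p) = of_real (?K p)" for p
    using gauss[of "fst p" "snd p"] by simp
  have intK: "integrable (M \<Otimes>\<^sub>M M) ?K"
    using s by (intro MM.integrable_const_bound[where B = "pi / s"])
      (auto simp: field_simps mult_left_le)
  have intE: "integrable lborel (\<lambda>\<xi>. (norm (fourier_transform M \<xi>))\<^sup>2 * exp (- (s * (norm \<xi>)\<^sup>2)))"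
    using P.integrable_fst[OF intF] unfolding energy[symmetric] complex_of_real_integrable_eq .
  have "complex_of_real (LINT \<xi>|lborel. (norm (fourier_transform M \<xi>))\<^sup>2 * exp (- (s * (norm \<xi>)\<^sup>2))) =
      of_real (LINT p|(M \<Otimes>\<^sub>M M). ?K p)"
    using P.Fubini_integral[OF intF]
    unfolding K_eq energy[symmetric] integral_complex_of_real by simp
  then have eq: "(LINT \<xi>|lborel. (norm (fourier_transform M \<xi>))\<^sup>2 * exp (- (s * (norm \<xi>)\<^sup>2))) =
      (LINT p|(M \<Otimes>\<^sub>M M). ?K p)"
    by (simp only: of_real_eq_iff)
  \<comment> \<open>Both integrands are nonnegative and integrable, so the identity of Bochner
    integrals carries over to extended nonnegative ones.\<close>
  have "(\<integral>\<^sup>+\<xi>. ennreal ((norm (fourier_transform M \<xi>))\<^sup>2 * exp (- (s * (norm \<xi>)\<^sup>2))) \<partial>lborel) =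
      ennreal (LINT p|(M \<Otimes>\<^sub>M M). ?K p)"
    by (subst nn_integral_eq_integral[OF intE]) (simp_all add: eq)
  also have "\<dots> = (\<integral>\<^sup>+p. ennreal (?K p) \<partial>(M \<Otimes>\<^sub>M M))"
    using s by (subst nn_integral_eq_integral[OF intK]) auto
  also have "\<dots> = (\<integral>\<^sup>+x. \<integral>\<^sup>+y. ennreal (?K (x, y)) \<partial>M \<partial>M)"
    by (rule nn_integral_fst[symmetric]) measurable
  finally show ?thesis by simp
qed

text \<open>The factor \<open>pi / s\<close> of the energy turns \<open>s powr \<beta>\<close> into
  \<open>s powr (\<beta> - 1)\<close>, which is integrable near 0 because \<beta> is positive; the
  weight \<open>exp (- s)\<close> secures convergence at infinity.\<close>

lemma in_H_minus_1I:
  assumes fin: "finite_measure M" and sets [measurable_cong]: "sets M = sets borel"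
    and \<beta>: "\<beta> > 0" and C: "C \<ge> 0"
    and bound: "\<And>s x. s > 0 \<Longrightarrow>
      (\<integral>\<^sup>+y. ennreal (exp (- ((norm (x - y))\<^sup>2 / (4 * s)))) \<partial>M) \<le> ennreal (C * s powr \<beta>)"
  shows "in_H_minus_1 M"
proof -
  interpret finite_measure M by fact
  have [measurable]: "fourier_transform M \<in> borel_measurable borel"
    unfolding fourier_transform_def by measurable
  let ?E = "\<lambda>s \<xi>. (norm (fourier_transform M \<xi>))\<^sup>2 * exp (- (s * (norm \<xi>)\<^sup>2))"
  \<comment> \<open>The half-line is taken open because the energy identity is available for
    positive \<open>s\<close> only; the end point is a null set.\<close>
  have resolvent: "ennreal (1 / l) = (\<integral>\<^sup>+s. ennreal (exp (- (s * l))) * indicator {0<..} s \<partial>lborel)"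
    if l: "l > 0" for l :: real
  proof -
    have "(\<integral>\<^sup>+s. ennreal (exp (- (s * l))) * indicator {0<..} s \<partial>lborel) =
        (\<integral>\<^sup>+s. ennreal (exp (- (s * l))) * indicator {0..} s \<partial>lborel)"
      by (intro nn_integral_cong_AE eventually_mono[OF AE_lborel_singleton[of 0]])
         (auto split: split_indicator)
    also have "\<dots> = ennreal (0 - (- exp (- (0 * l)) / l))"
    proof (rule nn_integral_FTC_atLeast)
      show "((\<lambda>s. - exp (- (s * l)) / l) \<longlongrightarrow> 0) at_top"
        using l by real_asymp
      show "((\<lambda>s. - exp (- (s * l)) / l) has_real_derivative exp (- (s * l))) (at s)" for s
        using l by (auto intro!: derivative_eq_intros)
    qed auto
    finally show ?thesis by simp
  qed
  have "(\<integral>\<^sup>+\<xi>. ennreal ((norm (fourier_transform M \<xi>))\<^sup>2 / (1 + (norm \<xi>)\<^sup>2)) \<partial>lborel) =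
      (\<integral>\<^sup>+\<xi>. \<integral>\<^sup>+s. ennreal (exp (- s) * ?E s \<xi>) * indicator {0<..} s \<partial>lborel \<partial>lborel)"
  proof (intro nn_integral_cong)
    fix \<xi> :: complex
    have l: "1 + (norm \<xi>)\<^sup>2 > 0" by (simp add: add_pos_nonneg)
    have exp_eq: "exp (- (s * (1 + (norm \<xi>)\<^sup>2))) = exp (- s) * exp (- (s * (norm \<xi>)\<^sup>2))" for s
      by (simp add: algebra_simps flip: exp_add)
    have "ennreal ((norm (fourier_transform M \<xi>))\<^sup>2 / (1 + (norm \<xi>)\<^sup>2)) =
        ennreal ((norm (fourier_transform M \<xi>))\<^sup>2) * ennreal (1 / (1 + (norm \<xi>)\<^sup>2))"
      by (simp flip: ennreal_mult')
    also have "\<dots> = (\<integral>\<^sup>+s. ennreal ((norm (fourier_transform M \<xi>))\<^sup>2) *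
        (ennreal (exp (- (s * (1 + (norm \<xi>)\<^sup>2)))) * indicator {0<..} s) \<partial>lborel)"
      unfolding resolvent[OF l] by (rule nn_integral_cmult[symmetric]) measurable
    also have "\<dots> = (\<integral>\<^sup>+s. ennreal (exp (- s) * ?E s \<xi>) * indicator {0<..} s \<partial>lborel)"
      unfolding exp_eq by (intro nn_integral_cong) (simp add: ennreal_mult' mult_ac)
    finally show "ennreal ((norm (fourier_transform M \<xi>))\<^sup>2 / (1 + (norm \<xi>)\<^sup>2)) = \<dots>" .
  qed
  also have "\<dots> = (\<integral>\<^sup>+s. \<integral>\<^sup>+\<xi>. ennreal (exp (- s) * ?E s \<xi>) * indicator {0<..} s \<partial>lborel \<partial>lborel)"
    by (rule lborel_pair.Fubini') measurable
  \<comment> \<open>The majorant is the integrand of Euler's integral for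
    \<open>Gamma \<beta>\<close>; the outer integration over \<open>x\<close> costs one factor of
    total mass.\<close>
  also have "\<dots> \<le> (\<integral>\<^sup>+s. ennreal (pi * C * measure M (space M)) *
      ennreal (indicator {0..} s * s powr (\<beta> - 1) / exp s) \<partial>lborel)"
  proof (intro nn_integral_mono)
    fix s :: real
    show "(\<integral>\<^sup>+\<xi>. ennreal (exp (- s) * ?E s \<xi>) * indicator {0<..} s \<partial>lborel) \<le>
      ennreal (pi * C * measure M (space M)) * ennreal (indicator {0..} s * s powr (\<beta> - 1) / exp s)"
    proof (cases "s > 0")
      case s: True
      have "(\<integral>\<^sup>+\<xi>. ennreal (?E s \<xi>) \<partial>lborel) =
        (\<integral>\<^sup>+x. \<integral>\<^sup>+y. ennreal (pi / s * exp (- ((norm (x - y))\<^sup>2 / (4 * s)))) \<partial>M \<partial>M)"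
        by (rule nn_integral_fourier_transform_gaussian[OF fin sets s])
      also have "\<dots> = (\<integral>\<^sup>+x. ennreal (pi / s) *
          (\<integral>\<^sup>+y. ennreal (exp (- ((norm (x - y))\<^sup>2 / (4 * s)))) \<partial>M) \<partial>M)"
        using s by (intro nn_integral_cong, subst nn_integral_cmult[symmetric])
          (auto simp flip: ennreal_mult')
      also have "\<dots> \<le> (\<integral>\<^sup>+x. ennreal (pi / s) * ennreal (C * s powr \<beta>) \<partial>M)"
        by (intro nn_integral_mono mult_left_mono bound s) simp
      also have "\<dots> = ennreal (pi / s * (C * s powr \<beta>) * measure M (space M))"
        using s C by (simp add: emeasure_eq_measure flip: ennreal_mult')
      also have "\<dots> = ennreal (pi * C * measure M (space M) * s powr (\<beta> - 1))"
        using s by (simp add: powr_diff mult_ac)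
      finally have "(\<integral>\<^sup>+\<xi>. ennreal (?E s \<xi>) \<partial>lborel) \<le>
        ennreal (pi * C * measure M (space M) * s powr (\<beta> - 1))" .
      from mult_left_mono[OF this, of "ennreal (exp (- s))"] s C show ?thesis
        by (simp add: ennreal_mult nn_integral_cmult mult_ac exp_minus divide_inverse)
    qed auto
  qed
  also have "\<dots> = ennreal (pi * C * measure M (space M)) * ennreal (Gamma \<beta>)"
    by (subst nn_integral_cmult) (simp_all add: Gamma_conv_nn_integral_real[OF \<beta>])
  also have "\<dots> < \<infinity>"
    by (simp add: ennreal_mult_less_top)
  finally show ?thesis
    using fin sets by (simp add: in_H_minus_1_def)
qed

section \<open>Gaussian integrals from the masses of annuli\<close>

text \<open>
  Since \<open>k\<^sup>2 / 4 \<ge> k - 1\<close>, the Gaussian is at most \<open>exp (1 - k)\<close> at distance between \<open>k \<surd>s\<close> and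
  \<open>(k + 1) \<surd>s\<close>; splitting according to \<open>k\<close> leaves a sum \<open>\<Sum>k. (k + 1) exp (- k)\<close>.
\<close>
lemma nn_integral_gaussian_le_annuli:
  fixes M :: "'a::euclidean_space measure"
  assumes sets [measurable_cong]: "sets M = sets borel"
    and \<alpha>: "0 < \<alpha>" "\<alpha> \<le> 1" and C: "C \<ge> 0"
    and ann: "\<And>\<rho> \<delta>. 0 \<le> \<rho> \<Longrightarrow> 0 < \<delta> \<Longrightarrow> emeasure M {y. \<bar>norm y - \<rho>\<bar> < \<delta>} \<le> ennreal (C * \<delta> powr \<alpha>)"
    and s: "s > 0"
  shows "(\<integral>\<^sup>+y. ennreal (exp (- ((norm (x - y))\<^sup>2 / (4 * s)))) \<partial>M) \<le>
    ennreal (exp 1 / (1 - exp (- 1))\<^sup>2 * C * s powr (\<alpha> / 2))"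
proof -
  \<comment> \<open>Full annuli instead of disjoint shells, so that \<open>ann\<close> applies
    directly with \<open>\<rho> = norm x\<close>; overlaps are harmless for an upper bound.\<close>
  define A where "A = (\<lambda>k::nat. {y::'a. \<bar>norm y - norm x\<bar> < (real k + 1) * sqrt s})"
  have A [measurable]: "A k \<in> sets borel" for k unfolding A_def by measurable
  have pt: "ennreal (exp (- ((norm (x - y))\<^sup>2 / (4 * s)))) \<le>
      (\<Sum>k. ennreal (exp 1 * exp (- 1) ^ k) * indicator (A k) y)" for y
  proof -
    define u where "u = \<bar>norm y - norm x\<bar>"
    define k where "k = nat \<lfloor>u / sqrt s\<rfloor>"
    have u: "u \<ge> 0" "u \<le> norm (x - y)"
      unfolding u_def using norm_triangle_ineq3[of x y] by (auto simp: abs_minus_commute)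
    have k1: "real k \<le> u / sqrt s" and k2: "u / sqrt s < real k + 1"
      unfolding k_def using u s by (auto intro: of_nat_floor)
    have yA: "y \<in> A k"
      using k2 s by (simp add: A_def u_def[symmetric] field_simps)
    have "(real k)\<^sup>2 \<le> (u / sqrt s)\<^sup>2"
      using k1 by (intro power_mono) auto
    also have "\<dots> = u\<^sup>2 / s" using s by (simp add: power_divide)
    also have "\<dots> \<le> (norm (x - y))\<^sup>2 / s"
      using u s by (intro divide_right_mono power_mono) auto
    finally have "(real k)\<^sup>2 / 4 \<le> (norm (x - y))\<^sup>2 / (4 * s)" by simp
    moreover have "real k - 1 \<le> (real k)\<^sup>2 / 4"
      using zero_le_power2[of "real k / 2 - 1"] by (simp add: power2_eq_square algebra_simps)
    ultimately have "exp (- ((norm (x - y))\<^sup>2 / (4 * s))) \<le> exp (1 - real k)"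
      by simp
    also have "\<dots> = exp 1 * exp (- 1) ^ k"
      by (simp add: exp_diff exp_minus exp_of_nat_mult[symmetric] divide_inverse power_inverse)
    finally have "ennreal (exp (- ((norm (x - y))\<^sup>2 / (4 * s)))) \<le>
        ennreal (exp 1 * exp (- 1) ^ k) * indicator (A k) y"
      using yA by (simp add: ennreal_leI)
    \<comment> \<open>The term for the shell containing \<open>y\<close> is one summand of a series
      of nonnegative terms.\<close>
    also have "\<dots> = (\<Sum>j\<in>{k}. ennreal (exp 1 * exp (- 1) ^ j) * indicator (A j) y)"
      by (simp only: sum.insert finite.emptyI empty_iff not_False_eq_True sum.empty add_0_right)
    also have "\<dots> \<le> (\<Sum>j. ennreal (exp 1 * exp (- 1) ^ j) * indicator (A j) y)"
      by (intro sum_le_suminf) auto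
    finally show ?thesis .
  qed
  have "(\<integral>\<^sup>+y. ennreal (exp (- ((norm (x - y))\<^sup>2 / (4 * s)))) \<partial>M) \<le>
     (\<integral>\<^sup>+y. (\<Sum>k. ennreal (exp 1 * exp (- 1) ^ k) * indicator (A k) y) \<partial>M)"
    by (intro nn_integral_mono pt)
  also have "\<dots> = (\<Sum>k. ennreal (exp 1 * exp (- 1) ^ k) * emeasure M (A k))"
    by (subst nn_integral_suminf) (auto simp: nn_integral_cmult_indicator)
  also have "\<dots> \<le> (\<Sum>k. ennreal (exp 1 * C * s powr (\<alpha> / 2) * (real (Suc k) * exp (- 1) ^ k)))"
  proof (intro suminf_le summableI)
    fix k
    have "((real k + 1) * sqrt s) powr \<alpha> = (real k + 1) powr \<alpha> * s powr (\<alpha> / 2)"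
      using s by (simp add: powr_mult powr_powr flip: powr_half_sqrt)
    \<comment> \<open>Raising the exponent from \<alpha> to 1 enlarges a power of
      \<open>real k + 1\<close>, which is at least 1; the resulting series is the differentiated
      geometric series.\<close>
    also have "\<dots> \<le> (real k + 1) powr 1 * s powr (\<alpha> / 2)"
      using \<alpha> by (intro mult_right_mono powr_mono) auto
    finally have *: "((real k + 1) * sqrt s) powr \<alpha> \<le> real (Suc k) * s powr (\<alpha> / 2)"
      by (simp add: add.commute)
    have "emeasure M (A k) \<le> ennreal (C * ((real k + 1) * sqrt s) powr \<alpha>)"
      unfolding A_def using s by (intro ann) auto
    also have "\<dots> \<le> ennreal (C * (real (Suc k) * s powr (\<alpha> / 2)))"
      by (intro ennreal_leI mult_left_mono * C)
    finally have "ennreal (exp 1 * exp (- 1) ^ k) * emeasure M (A k) \<le>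
        ennreal (exp 1 * exp (- 1) ^ k) * ennreal (C * (real (Suc k) * s powr (\<alpha> / 2)))"
      by (intro mult_left_mono) auto
    also have "\<dots> = ennreal (exp 1 * C * s powr (\<alpha> / 2) * (real (Suc k) * exp (- 1) ^ k))"
      using C by (subst ennreal_mult[symmetric]) (auto simp: mult_ac)
    finally show "ennreal (exp 1 * exp (- 1) ^ k) * emeasure M (A k) \<le> \<dots>" .
  qed
  also have "\<dots> = ennreal (exp 1 * C * s powr (\<alpha> / 2) * (1 / (1 - exp (- 1))\<^sup>2))"
  proof (rule suminf_ennreal_eq)
    show "(\<lambda>k. exp 1 * C * s powr (\<alpha> / 2) * (real (Suc k) * exp (- 1) ^ k)) sums
        (exp 1 * C * s powr (\<alpha> / 2) * (1 / (1 - exp (- 1))\<^sup>2))"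
      by (intro sums_mult geometric_deriv_sums) simp
  qed (use C in auto)
  finally show ?thesis by (simp add: mult_ac)
qed

section \<open>Power laws for the masses of balls\<close>

text \<open>Subadditivity of the power handles \<open>l \<le> 1\<close>, the mean value theorem
  handles \<open>l > 1\<close>. The constant adds the two that arise, 1 and
  \<open>l * R powr (l - 1)\<close>, so that one formula serves both cases.\<close>

lemma powr_diff_le_holder:
  fixes a b R l :: real
  assumes "0 \<le> a" "a \<le> b" "b \<le> R" "l > 0"
  shows "b powr l - a powr l \<le> (1 + l * R powr (l - 1)) * (b - a) powr (min l 1)"
proof (cases "b = a")
  case False
  with assms have b: "b > 0" "a < b" by auto
  show ?thesis
  proof (cases "l \<le> 1")
    case True
    have ge: "x \<le> x powr l" if "0 \<le> x" "x \<le> 1" for x :: real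
      using that True assms powr_mono'[of l 1 x] by (cases "x = 0") auto
    \<comment> \<open>Subadditivity of \<open>x powr l\<close>: both fractions lie in the unit interval, where \<open>x \<le> x powr l\<close>.\<close>
    have "1 = a / b + (b - a) / b" using b by (simp add: field_simps)
    also have "\<dots> \<le> (a / b) powr l + ((b - a) / b) powr l"
      using assms b by (intro add_mono ge) auto
    also have "\<dots> = (a powr l + (b - a) powr l) / b powr l"
      using assms b by (simp add: powr_divide add_divide_distrib)
    finally have "b powr l - a powr l \<le> (b - a) powr l"
      using b by (simp add: field_simps)
    also have "\<dots> \<le> (1 + l * R powr (l - 1)) * (b - a) powr l"
      using assms by (simp add: distrib_right)
    finally show ?thesis using True by (simp add: min_def)
  next
    case False
    \<comment> \<open>Since \<open>a\<close> is nonnegative, \<open>a < x\<close> keeps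
      \<open>x\<close> away from 0.\<close>
    have deriv: "((\<lambda>x. x powr l) has_real_derivative l * x powr (l - 1)) (at x)" if "a < x" for x
      using that assms by (intro has_real_derivative_powr) auto
    have "\<exists>d z. a < z \<and> z < b \<and> ((\<lambda>x. x powr l) has_real_derivative d) (at z) \<and>
        b powr l - a powr l = (b - a) * d"
    proof (rule MVT)
      show "continuous_on {a..b} (\<lambda>x. x powr l)"
        using assms by (intro continuous_on_powr') (auto intro!: continuous_intros)
      show "(\<lambda>x. x powr l) differentiable at x" if "a < x" for x
        using deriv[OF that] real_differentiable_def by blast
    qed (fact b)
    then obtain z d where z: "a < z" "z < b" "((\<lambda>x. x powr l) has_real_derivative d) (at z)"
      and d: "b powr l - a powr l = (b - a) * d"
      by blast
    have d_eq: "d = l * z powr (l - 1)"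
      using DERIV_unique[OF z(3) deriv[OF z(1)]] .
    have "z powr (l - 1) \<le> R powr (l - 1)"
      using z assms False by (intro powr_mono2) auto
    then have "b powr l - a powr l \<le> (b - a) * (l * R powr (l - 1))"
      unfolding d d_eq using assms b by (intro mult_left_mono) auto
    also have "\<dots> \<le> (1 + l * R powr (l - 1)) * (b - a)"
      using b by (simp add: algebra_simps)
    finally show ?thesis using False b by (simp add: min_def)
  qed
qed auto

text \<open>An annulus is a difference of concentric balls, so its mass is an increment of
  \<open>c * r powr l\<close>, to which the Hoelder bound applies; restriction to
  \<open>ball 0 R\<close> keeps the Hoelder constant uniform.\<close>

lemma in_H_minus_1_density_ball:
  assumes sets [measurable_cong]: "sets M = sets borel" and l: "l > 0" and R: "R > 0"
    and fin: "\<And>r. r > 0 \<Longrightarrow> emeasure M (ball 0 r) < \<infinity>"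
    and law: "\<And>r. r > 0 \<Longrightarrow> measure M (ball 0 r) = c * r powr l"
  shows "in_H_minus_1 (density M (indicator (ball 0 R)))"
proof -
  let ?N = "density M (indicator (ball 0 R))"
  have sp: "space M = UNIV" using sets_eq_imp_space_eq[OF sets] by simp
  have emN: "emeasure ?N A = emeasure M (ball 0 R \<inter> A)" if "A \<in> sets borel" for A
  proof -
    have ball: "ball 0 R \<in> sets M" and A: "A \<in> sets M" using that by (auto simp: sets)
    then show ?thesis
      by (simp add: emeasure_density borel_measurable_indicator sets.Int flip: indicator_inter_arith)
  qed
  have finN: "finite_measure ?N"
    by (rule finite_measureI) (use emN[of UNIV] fin[OF R] sp in auto)
  have c: "c \<ge> 0"
    using law[of 1] measure_nonneg[of M "ball 0 1"] by simp
  \<comment> \<open>The radius 0 is included for annuli that reach the centre: the ball is empty and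
    \<open>0 powr l\<close> is 0.\<close>
  have law': "emeasure M (ball 0 r) = ennreal (c * r powr l)" if "r \<ge> 0" for r
    using that fin[of r] law[of r] by (cases "r = 0") (auto simp: emeasure_eq_ennreal_measure)
  define \<alpha> where "\<alpha> = min l 1"
  \<comment> \<open>The factor \<open>2 powr \<alpha>\<close> appears because an annulus of
    half-width \<delta> has thickness up to \<open>2 * \<delta>\<close>.\<close>
  define C where "C = c * (1 + l * R powr (l - 1)) * 2 powr \<alpha>"
  have \<alpha>: "0 < \<alpha>" "\<alpha> \<le> 1" and C: "C \<ge> 0" using l c by (auto simp: \<alpha>_def C_def)
  have ann: "emeasure ?N {y. \<bar>norm y - \<rho>\<bar> < \<delta>} \<le> ennreal (C * \<delta> powr \<alpha>)"
    if "0 \<le> \<rho>" "0 < \<delta>" for \<rho> \<delta>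
  proof -
    define a where "a = max 0 (\<rho> - \<delta>)"
    define b where "b = min R (\<rho> + \<delta>)"
    have ab: "0 \<le> a" "b \<le> R" "0 \<le> b" "b - a \<le> 2 * \<delta>"
      using that R by (auto simp: a_def b_def)
    have "emeasure ?N {y. \<bar>norm y - \<rho>\<bar> < \<delta>} = emeasure M (ball 0 R \<inter> {y. \<bar>norm y - \<rho>\<bar> < \<delta>})"
      by (rule emN) measurable
    also have "\<dots> \<le> emeasure M (ball 0 b - ball 0 a)"
      by (rule emeasure_mono) (auto simp: a_def b_def sets max_def split: if_splits)
    also have "\<dots> \<le> ennreal (C * \<delta> powr \<alpha>)"
    proof (cases "a \<le> b")
      case True
      have "emeasure M (ball 0 b - ball 0 a) = emeasure M (ball 0 b) - emeasure M (ball 0 a)"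
        using True law'[OF ab(1)] by (intro emeasure_Diff) (auto simp: sets)
      also have "\<dots> = ennreal (c * (b powr l - a powr l))"
        using ab c by (simp add: law' ennreal_minus right_diff_distrib)
      also have "\<dots> \<le> ennreal (c * ((1 + l * R powr (l - 1)) * (2 * \<delta>) powr \<alpha>))"
      proof (intro ennreal_leI mult_left_mono c)
        have "b powr l - a powr l \<le> (1 + l * R powr (l - 1)) * (b - a) powr \<alpha>"
          unfolding \<alpha>_def using ab True l by (intro powr_diff_le_holder) auto
        also have "\<dots> \<le> (1 + l * R powr (l - 1)) * (2 * \<delta>) powr \<alpha>"
          using ab True l \<alpha> by (intro mult_left_mono powr_mono2) auto
        finally show "b powr l - a powr l \<le> \<dots>" .
      qed
      finally show ?thesis
        using that by (simp add: C_def powr_mult mult_ac)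
    next
      \<comment> \<open>Here the annulus lies entirely outside \<open>ball 0 R\<close>.\<close>
      case False
      then have "ball 0 b - ball 0 a = ({} :: complex set)" by auto
      then show ?thesis by (simp only: emeasure_empty zero_le)
    qed
    finally show ?thesis .
  qed
  show ?thesis
  proof (rule in_H_minus_1I[OF finN])
    show "(\<integral>\<^sup>+y. ennreal (exp (- ((norm (x - y))\<^sup>2 / (4 * s)))) \<partial>?N) \<le>
        ennreal (exp 1 / (1 - exp (- 1))\<^sup>2 * C * s powr (\<alpha> / 2))" if "s > 0" for s x
      using nn_integral_gaussian_le_annuli[OF _ \<alpha> C ann that] sets by simp
  qed (use \<alpha> C sets in auto)
qed

section \<open>Self-similar spirals at a fixed time\<close>

theorem mainTheorem4:
  fixes m lam :: real
    and I :: "real set" and f g :: "real \<Rightarrow> real"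
    and \<Gamma> :: "real \<Rightarrow> complex measure" and c\<^sub>2 :: "real \<Rightarrow> real"
  assumes "kaden_spiral m I f g \<Gamma> \<or> anton_spiral m I f g \<Gamma> \<or> pullin_spiral m I f g \<Gamma>"
    and "lam > 0" and "lam = 2 - 1 / m"
    and "similitude_law \<Gamma> c\<^sub>2 lam"
  shows "(kaden_spiral m I f g \<Gamma> \<or> anton_spiral m I f g \<Gamma> \<longrightarrow> lam = 1 / 2) \<and>
    (\<forall>t>0. locally_in_H_minus_1 (\<Gamma> t))"
proof (intro conjI impI allI)
  assume "kaden_spiral m I f g \<Gamma> \<or> anton_spiral m I f g \<Gamma>"
  then have "m = 2 / 3" by (auto simp: kaden_spiral_def anton_spiral_def)
  then show "lam = 1 / 2" using assms(3) by (simp only:) simp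
next
  fix t :: real assume t: "t > 0"
  have "sets (\<Gamma> t) = sets borel"
    using assms(1) t
    by (auto simp: kaden_spiral_def anton_spiral_def pullin_spiral_def self_similar_spiral_def
        generated_measure_def)
  \<comment> \<open>With \<open>t\<close> fixed, the coefficient \<open>c\<^sub>2 t\<close> is a
    constant and the similitude law is the radial power law of the preceding lemma.\<close>
  then show "locally_in_H_minus_1 (\<Gamma> t)"
    unfolding locally_in_H_minus_1_def
    using assms(2,4) t
    by (auto simp: similitude_law_def intro!: in_H_minus_1_density_ball[where l = lam and c = "c\<^sub>2 t"])
qed

end
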